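(* The root lattice $\mathsf E_8$ does not give a locally optimal lattice sphere covering; that is, if $Q_{\mathsf E_8}$ is a positive definite quadratic form associated to $\mathsf E_8$, there is no neighborhood $U$ of $Q_{\mathsf E_8}$ in $\mathcal S^8_{>0}$ such that $\Theta(Q_{\mathsf E_8})\le\Theta(Q')$ for all $Q'\in U$.
   Context: The root lattice is $\mathsf E_8=\{\boldsymbol x\in\mathbb R^8:\ \boldsymbol x\in\mathbb Z^8\cup(\tfrac12+\mathbb Z)^8,\ \sum_{i=1}^8x_i\in2\mathbb Z\}$. $\mathcal S^d$ is the real vector space of quadratic forms in $d$ variables, identified with real symmetric $d\times d$ matrices, $Q[\boldsymbol x]=\boldsymbol x^tQ\boldsymbol x$; $\mathcal S^d_{>0}$ is the open cone of positive definite quadratic forms (PQFs). A lattice in $\mathbb R^d$ is $L=A\mathbb Z^d$ with $A\in\mathsf{GL}_d(\mathbb R)$; for each such basis $A$ of $L$ the PQF $Q=A^tA$ is said to be associated to $L$. The inhomogeneous minimum is $\mu(Q)=\max_{\boldsymbol x\in\mathbb R^d}\min_{\boldsymbol v\in\mathbb Z^d}Q[\boldsymbol x-\boldsymbol v]$, and the covering density is $\Theta(Q)=\sqrt{\mu(Q)^d/\det Q}\cdot\kappa_d$, where $\kappa_d=\pi^{d/2}/\Gamma(d/2+1)$ is the volume of the unit ball in $\mathbb R^d$. A lattice $L$ with associated PQF $Q$ gives a locally optimal lattice covering if there is a neighborhood of $Q$ in $\mathcal S^d_{>0}$ such that $\Theta(Q)\le\Theta(Q')$ for all $Q'$ in this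 neighborhood. *)

theory Defs
  imports "HOL-Analysis.Analysis"
begin

definition quad_form :: "real^'d^'d \<Rightarrow> real^'d \<Rightarrow> real" where
  "quad_form Q x = x \<bullet> (Q *v x)"

definition sym_forms :: "(real^'d^'d) set" where
  "sym_forms = {Q. transpose Q = Q}"

definition pqfs :: "(real^'d^'d) set" where
  "pqfs = {Q \<in> sym_forms. \<forall>x. x \<noteq> 0 \<longrightarrow> quad_form Q x > 0}"

definition int_vecs :: "(real^'d) set" where
  "int_vecs = {v. \<forall>i. v $ i \<in> \<int>}"

text \<open>The columns of \<open>A\<close> form the basis of \<open>L\<close>.\<close>

definition is_basis_matrix :: "real^'d^'d \<Rightarrow> (real^'d) set \<Rightarrow> bool" where
  "is_basis_matrix A L \<longleftrightarrow> invertible A \<and> L = (\<lambda>z. A *v z) ` int_vecs"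

definition associated_form :: "real^'d^'d \<Rightarrow> (real^'d) set \<Rightarrow> bool" where
  "associated_form Q L \<longleftrightarrow> (\<exists>A. is_basis_matrix A L \<and> Q = transpose A ** A)"

text \<open>For positive definite \<open>Q\<close> the infimum is a minimum and the supremum is a maximum;
  see \<open>inhom_min_inner_attained\<close> and \<open>inhom_min_attained\<close> below.\<close>

definition inhom_min :: "real^'d^'d \<Rightarrow> real" where
  "inhom_min Q = (SUP x. INF v\<in>int_vecs. quad_form Q (x - v))"

definition covering_density :: "real^'d^'d \<Rightarrow> real" where
  "covering_density Q =
     sqrt (inhom_min Q ^ CARD('d) / det Q) * unit_ball_vol (real CARD('d))"

definition pqf_neighborhood :: "(real^'d^'d) set \<Rightarrow> real^'d^'d \<Rightarrow> bool" where
  "pqf_neighborhood U Q \<longleftrightarrow>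
     U \<subseteq> pqfs \<and> (\<exists>V. openin (top_of_set pqfs) V \<and> Q \<in> V \<and> V \<subseteq> U)"

definition locally_optimal_covering :: "(real^'d) set \<Rightarrow> bool" where
  "locally_optimal_covering L \<longleftrightarrow>
     (\<exists>Q. associated_form Q L \<and>
        (\<exists>U. pqf_neighborhood U Q \<and> (\<forall>Q'\<in>U. covering_density Q \<le> covering_density Q')))"

definition E8 :: "(real^8) set" where
  "E8 = {x. ((\<forall>i. x $ i \<in> \<int>) \<or> (\<forall>i. x $ i - 1/2 \<in> \<int>)) \<and>
            (\<exists>k::int. (\<Sum>i\<in>UNIV. x $ i) = 2 * of_int k)}"


lemma quad_form_scaleR: "quad_form Q (c *\<^sub>R x) = c\<^sup>2 * quad_form Q x"
  by (simp add: quad_form_def matrix_vector_mult_scaleR power2_eq_square)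

lemma continuous_on_quad_form:
  assumes "continuous_on S f"
  shows "continuous_on S (\<lambda>x. quad_form Q (f x))"
  unfolding quad_form_def
  by (intro continuous_on_inner assms
      bounded_linear.continuous_on[OF matrix_vector_mul_bounded_linear assms])

lemma pqf_nonneg: "Q \<in> pqfs \<Longrightarrow> quad_form Q x \<ge> 0"
  by (cases "x = 0") (auto simp: pqfs_def quad_form_def less_imp_le)

lemma pqf_coercive:
  fixes Q :: "real^'d^'d"
  assumes "Q \<in> pqfs"
  obtains c where "c > 0" "\<And>x. quad_form Q x \<ge> c * (norm x)\<^sup>2"
proof -
  obtain u :: "real^'d" where u: "u \<in> sphere 0 1" "\<And>y. y \<in> sphere 0 1 \<Longrightarrow> quad_form Q u \<le> quad_form Q y"
    using continuous_attains_inf[of "sphere 0 1 :: (real^'d) set" "quad_form Q"]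
      continuous_on_quad_form[OF continuous_on_id, of "sphere 0 1" Q] by auto
  have "u \<noteq> 0" using u(1) by auto
  then have "quad_form Q u > 0" using assms by (auto simp: pqfs_def)
  moreover have "quad_form Q x \<ge> quad_form Q u * (norm x)\<^sup>2" for x
  proof (cases "x = 0")
    case True
    then show ?thesis by (simp add: quad_form_def)
  next
    case False
    then have "quad_form Q u \<le> quad_form Q ((1 / norm x) *\<^sub>R x)"
      by (intro u(2)) auto
    then show ?thesis using False by (simp add: quad_form_scaleR field_simps)
  qed
  ultimately show ?thesis using that by blast
qed

lemma zero_in_int_vecs: "0 \<in> int_vecs"
  by (simp add: int_vecs_def)

lemma closed_int_vecs: "closed (int_vecs :: (real^'d) set)"
proof -
  have *: "int_vecs = (\<Inter>i. (\<lambda>v::real^'d. v $ i) -` \<int>)"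
    by (auto simp: int_vecs_def)
  have "closed ((\<lambda>v::real^'d. v $ i) -` \<int>)" for i
    by (intro continuous_closed_vimage closed_Ints) (auto intro!: continuous_intros)
  then show ?thesis unfolding * by blast
qed

lemma inhom_min_inner_attained:
  fixes Q :: "real^'d^'d"
  assumes "Q \<in> pqfs"
  shows "\<exists>v\<in>int_vecs. (INF w\<in>int_vecs. quad_form Q (x - w)) = quad_form Q (x - v) \<and>
           (\<forall>w\<in>int_vecs. quad_form Q (x - v) \<le> quad_form Q (x - w))"
proof -
  obtain c where c: "c > 0" "\<And>x. quad_form Q x \<ge> c * (norm x)\<^sup>2"
    using pqf_coercive[OF assms] by blast
  define K where "K = int_vecs \<inter> {v. quad_form Q (x - v) \<le> quad_form Q x}"
  have "closed {v. quad_form Q (x - v) \<le> quad_form Q x}"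
    by (intro closed_Collect_le continuous_on_quad_form continuous_intros)
  then have "closed K" unfolding K_def using closed_int_vecs by blast
  moreover have "K \<subseteq> cball x (sqrt (quad_form Q x / c))"
  proof
    fix v assume "v \<in> K"
    then have "c * (norm (x - v))\<^sup>2 \<le> quad_form Q x"
      using c(2)[of "x - v"] by (auto simp: K_def)
    then have "(norm (x - v))\<^sup>2 \<le> quad_form Q x / c"
      using c(1) by (simp add: field_simps)
    then show "v \<in> cball x (sqrt (quad_form Q x / c))"
      by (simp add: dist_norm real_le_rsqrt)
  qed
  ultimately have "compact K"
    using bounded_cball bounded_subset compact_eq_bounded_closed by blast
  moreover have "0 \<in> K" by (simp add: K_def zero_in_int_vecs)
  ultimately obtain v where v: "v \<in> K" "\<And>w. w \<in> K \<Longrightarrow> quad_form Q (x - v) \<le> quad_form Q (x - w)"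
    using continuous_attains_inf[of K "\<lambda>v. quad_form Q (x - v)"]
      continuous_on_quad_form[of K "\<lambda>v. x - v" Q] continuous_on_diff[OF continuous_on_const continuous_on_id]
    by blast
  have le: "quad_form Q (x - v) \<le> quad_form Q (x - w)" if "w \<in> int_vecs" for w
    using v that by (cases "w \<in> K") (auto simp: K_def)
  moreover have "(INF w\<in>int_vecs. quad_form Q (x - w)) = quad_form Q (x - v)"
    using v(1) le by (intro cInf_eq_minimum) (auto simp: K_def)
  ultimately show ?thesis using v(1) by (auto simp: K_def)
qed

lemma inhom_min_attained:
  fixes Q :: "real^'d^'d"
  assumes "Q \<in> pqfs"
  shows "\<exists>x. inhom_min Q = (INF v\<in>int_vecs. quad_form Q (x - v)) \<and>
           (\<forall>y. (INF v\<in>int_vecs. quad_form Q (y - v)) \<le> (INF v\<in>int_vecs. quad_form Q (x - v)))"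
proof -
  define f where "f x = (INF v\<in>int_vecs. quad_form Q (x - v))" for x
  have f_less: "f x < a \<longleftrightarrow> (\<exists>v\<in>int_vecs. quad_form Q (x - v) < a)" for x a
    unfolding f_def using inhom_min_inner_attained[OF assms, of x] by force
  have "open {x. f x < a}" for a
  proof -
    have "{x. f x < a} = (\<Union>v\<in>int_vecs. {x. quad_form Q (x - v) < a})"
      using f_less by auto
    moreover have "open {x. quad_form Q (x - v) < a}" for v
      by (intro open_Collect_less continuous_on_quad_form continuous_intros)
    ultimately show ?thesis by auto
  qed
  note op = this
  define C where "C = cbox (0 :: real^'d) (\<chi> i. 1)"
  have red: "\<exists>z\<in>C. f z = f y" for y :: "real^'d"
  proof
    define u where "u = (\<chi> i. real_of_int \<lfloor>y $ i\<rfloor>)"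
    have u: "u \<in> int_vecs" by (simp add: u_def int_vecs_def)
    show "y - u \<in> C"
      by (auto simp: C_def mem_box_cart u_def) linarith+
    have "(\<lambda>v. quad_form Q (y - u - v)) ` int_vecs = (\<lambda>v. quad_form Q (y - v)) ` int_vecs"
    proof (intro subset_antisym image_subsetI)
      fix v :: "real^'d" assume "v \<in> int_vecs"
      then have "u + v \<in> int_vecs" "v - u \<in> int_vecs" using u by (auto simp: int_vecs_def)
      then show "quad_form Q (y - u - v) \<in> (\<lambda>v. quad_form Q (y - v)) ` int_vecs"
        and "quad_form Q (y - v) \<in> (\<lambda>v. quad_form Q (y - u - v)) ` int_vecs"
        by (auto simp: image_iff diff_diff_eq intro: bexI[where x="u + v"] bexI[where x="v - u"])
    qed
    then show "f (y - u) = f y" by (simp add: f_def)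
  qed
  have "\<exists>x\<in>C. \<forall>y\<in>C. f y \<le> f x"
  proof (rule ccontr)
    assume "\<not> ?thesis"
    then have "C \<subseteq> (\<Union>y\<in>C. {x. f x < f y})" by (auto simp: not_le)
    moreover have "compact C" by (simp add: C_def compact_cbox)
    ultimately obtain D where D: "D \<subseteq> C" "finite D" "C \<subseteq> (\<Union>y\<in>D. {x. f x < f y})"
      using op compactE_image[of C C "\<lambda>y. {x. f x < f y}"] by metis
    have "C \<noteq> {}" using red by auto
    then have "D \<noteq> {}" using D(3) by auto
    then have "Max (f ` D) \<in> f ` D" using D(2) by simp
    then obtain m where "m \<in> D" "f m = Max (f ` D)" by (auto simp del: Max_in)
    moreover from this D obtain y where "y \<in> D" "f m < f y" by auto
    moreover have "f y \<le> Max (f ` D)" using D(2) \<open>y \<in> D\<close> by simp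
    ultimately show False by simp
  qed
  then obtain x where x: "\<And>y. f y \<le> f x" using red by metis
  then have "inhom_min Q = f x"
    unfolding inhom_min_def f_def[symmetric] by (intro cSup_eq_maximum) auto
  then show ?thesis using x unfolding f_def by blast
qed

lemma associated_form_pqf:
  fixes Q :: "real^'d^'d"
  assumes "associated_form Q L"
  shows "Q \<in> pqfs"
proof -
  obtain A :: "real^'d^'d" where A: "invertible A" "Q = transpose A ** A"
    using assms unfolding associated_form_def is_basis_matrix_def by blast
  have "quad_form Q x = (A *v x) \<bullet> (A *v x)" for x
    by (simp add: quad_form_def A(2) dot_lmul_matrix inner_commute flip: matrix_vector_mul_assoc)
       (metis dot_lmul_matrix inner_commute transpose_matrix_vector)
  moreover have "A *v x \<noteq> 0" if "x \<noteq> 0" for x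
    using A(1) that by (metis invertible_def matrix_left_invertible_ker)
  ultimately show ?thesis
    by (auto simp: pqfs_def sym_forms_def A(2) matrix_transpose_mul transpose_transpose)
qed

lemma exhaust_8:
  fixes x :: 8
  shows "x = 1 \<or> x = 2 \<or> x = 3 \<or> x = 4 \<or> x = 5 \<or> x = 6 \<or> x = 7 \<or> x = 8"
proof (induct x)
  case (of_int z)
  then have "z = 0 \<or> z = 1 \<or> z = 2 \<or> z = 3 \<or> z = 4 \<or> z = 5 \<or> z = 6 \<or> z = 7" by fastforce
  then show ?case by auto
qed

lemma forall_8:
  "(\<forall>i::8. P i) \<longleftrightarrow> P 1 \<and> P 2 \<and> P 3 \<and> P 4 \<and> P 5 \<and> P 6 \<and> P 7 \<and> P 8"
  by (metis exhaust_8)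

lemma sum_8: "sum f (UNIV::8 set) = f 1 + f 2 + f 3 + f 4 + f 5 + f 6 + f 7 + f 8"
proof -
  have *: "(UNIV::8 set) = {1, 2, 3, 4, 5, 6, 7, 8}" using exhaust_8 by auto
  show ?thesis unfolding * by (simp add: add.assoc)
qed

lemma E8_associated_form_exists: "\<exists>Q. associated_form Q E8"
proof -
  define f :: "real^8 \<Rightarrow> real^8" where "f z = (\<chi> i.
    if i = 1 then 2 * z$1 - z$2 + z$8 / 2 else
    if i = 2 then z$2 - z$3 + z$8 / 2 else
    if i = 3 then z$3 - z$4 + z$8 / 2 else
    if i = 4 then z$4 - z$5 + z$8 / 2 else
    if i = 5 then z$5 - z$6 + z$8 / 2 else
    if i = 6 then z$6 - z$7 + z$8 / 2 else
    if i = 7 then z$7 + z$8 / 2 else z$8 / 2)" for z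
  define g :: "real^8 \<Rightarrow> real^8" where "g x = (\<chi> i.
    if i = 1 then (x$1 + x$2 + x$3 + x$4 + x$5 + x$6 + x$7 - 7 * x$8) / 2 else
    if i = 2 then x$2 + x$3 + x$4 + x$5 + x$6 + x$7 - 6 * x$8 else
    if i = 3 then x$3 + x$4 + x$5 + x$6 + x$7 - 5 * x$8 else
    if i = 4 then x$4 + x$5 + x$6 + x$7 - 4 * x$8 else
    if i = 5 then x$5 + x$6 + x$7 - 3 * x$8 else
    if i = 6 then x$6 + x$7 - 2 * x$8 else
    if i = 7 then x$7 - x$8 else 2 * x$8)" for x
  have lin: "linear f"
    by (rule linearI) (auto simp: f_def vec_eq_iff forall_8 field_simps)
  have gf: "g (f z) = z" and fg: "f (g x) = x" for z x
    by (auto simp: f_def g_def vec_eq_iff forall_8 field_simps)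
  have A: "matrix f *v z = f z" for z
    by (simp add: lin matrix_works)
  have "inj ((*v) (matrix f))"
    unfolding A inj_on_def by (metis gf)
  then have inv: "invertible (matrix f)"
    by (metis invertible_left_inverse matrix_left_invertible_injective)
  have "f z \<in> E8" if "z \<in> int_vecs" for z
  proof -
    have Z: "z$i \<in> \<int>" for i using that by (simp add: int_vecs_def)
    obtain k1 k8 where k: "z$1 = of_int k1" "z$8 = of_int k8" using Z by (metis Ints_cases)
    have "(\<Sum>i\<in>UNIV. f z $ i) = 2 * of_int (k1 + 2 * k8)"
      by (simp add: sum_8 f_def k)
    moreover have "(\<forall>i. f z $ i \<in> \<int>) \<or> (\<forall>i. f z $ i - 1/2 \<in> \<int>)"
    proof (cases "even k8")
      case True
      then obtain m where m: "z$8 / 2 = of_int m" using k by (auto elim!: evenE)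
      then show ?thesis unfolding forall_8 using Z by (simp add: f_def)
    next
      case False
      then obtain m where m: "z$8 / 2 = of_int m + 1/2" using k by (auto elim!: oddE)
      have h: "a + z$8 / 2 - 1/2 \<in> \<int>" if "a \<in> \<int>" for a
        using that by (simp add: m)
      have "\<forall>i. f z $ i - 1/2 \<in> \<int>"
        unfolding forall_8 using h[of "2 * z$1 - z$2"] h[of "z$2 - z$3"] h[of "z$3 - z$4"]
          h[of "z$4 - z$5"] h[of "z$5 - z$6"] h[of "z$6 - z$7"] h[of "z$7"] h[of 0] Z
        by (simp add: f_def)
      then show ?thesis by blast
    qed
    ultimately show ?thesis unfolding E8_def by blast
  qed
  moreover have "g x \<in> int_vecs" if x: "x \<in> E8" for x
  proof -
    have d: "x$i - x$8 \<in> \<int>" for i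
    proof -
      have "x$i - x$8 = (x$i - 1/2) - (x$8 - 1/2)" by simp
      then show ?thesis using that unfolding E8_def by (smt (verit) Ints_diff mem_Collect_eq)
    qed
    have d8: "2 * x$8 \<in> \<int>"
    proof (cases "x$8 \<in> \<int>")
      case False
      then have "2 * (x$8 - 1/2) + 1 \<in> \<int>" using that unfolding E8_def by (intro Ints_add Ints_mult) auto
      then show ?thesis by simp
    qed auto
    obtain k :: int where k: "x$1 + x$2 + x$3 + x$4 + x$5 + x$6 + x$7 + x$8 = 2 * of_int k"
      using x unfolding E8_def sum_8 by blast
    have "g x $ 1 = of_int k - 2 * (2 * x$8)"
      using k by (simp add: g_def field_simps)
    then have 1: "g x $ 1 \<in> \<int>" using d8 by (metis Ints_diff Ints_mult Ints_numeral Ints_of_int)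
    have 7: "g x $ 7 = x$7 - x$8" "g x $ 8 = 2 * x$8" by (simp_all add: g_def)
    have "g x $ 6 = g x $ 7 + (x$6 - x$8)" "g x $ 5 = g x $ 6 + (x$5 - x$8)"
      "g x $ 4 = g x $ 5 + (x$4 - x$8)" "g x $ 3 = g x $ 4 + (x$3 - x$8)"
      "g x $ 2 = g x $ 3 + (x$2 - x$8)" by (simp_all add: g_def)
    then show ?thesis
      unfolding int_vecs_def mem_Collect_eq forall_8 using 1 7 d d8 by (metis Ints_add)
  qed
  ultimately have "E8 = (\<lambda>z. matrix f *v z) ` int_vecs"
    unfolding A by (metis (no_types, lifting) fg image_eqI image_subsetI subsetI subset_antisym)
  then show ?thesis
    using inv by (auto simp: associated_form_def is_basis_matrix_def)
qed

end

theory Submission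
  imports Defs
begin

text \<open>
  Stretch the lattice in one coordinate: for a basis \<open>A\<close> of \<open>E8\<close> replace \<open>A\<^sup>tA\<close> by
  \<open>A\<^sup>t D A\<close> with \<open>D = diag(1 + t, 1, \<dots>, 1)\<close> and \<open>t > 0\<close> small. The determinant grows by the factor
  \<open>1 + t\<close>, so the covering density decreases as soon as the squared covering radius, which
  is \<open>1\<close> at \<open>t = 0\<close>, grows by a factor at most \<open>1 + ct\<close> with a constant \<open>c < 1/8\<close>;
  \<open>c = 1/10\<close> is achieved.

  The reason is the shape of the deep holes, the points at distance \<open>1\<close> from the lattice.
  The lattice points nearest to a deep hole \<open>x\<close> are the vertices \<open>x \<plusminus> u\<close> of a cross polytope,
  with \<open>u\<close> running through an orthonormal frame. A point near \<open>x\<close>, whatever its direction from \<open>x\<close>,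
  has moved away from at most one of \<open>x + u\<close> and \<open>x - u\<close>, so to first order every single \<open>u\<close>
  bounds the stretched distance of the hole from the lattice, by its own stretched length, whose
  square is \<open>1 + t u\<^sub>1\<^sup>2\<close>. Over the frame \<open>\<Sum>u\<^sub>1\<^sup>2 = 1\<close>, and all \<open>4u\<^sub>1\<close> are integers, so some
  \<open>u\<^sub>1\<^sup>2\<close> is at most \<open>1/16\<close>, below the average \<open>1/8\<close>.

  Only one such pair \<open>\<plusminus>u\<close> is needed, and \<open>deep_hole_antipodal\<close> finds it. Its key is the
  elementary inequality \<open>remainder_dichotomy\<close> on the distances of the coordinates of \<open>x\<close> to
  the nearest integers, and it also gives the covering radius \<open>1\<close>. This
  radius then confines the moved hole to a ball of radius \<open>O(t)\<close> about \<open>x\<close>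
  (\<open>deep_hole_descent\<close>); inside this ball the pair \<open>\<plusminus>u\<close> wins up to an error \<open>O(t\<^sup>2)\<close>
  (\<open>covered_near_deep_hole\<close>). Away from the deep holes the distance to the lattice is below \<open>1\<close>
  and a small stretch is harmless; compactness of a period of the lattice makes the bound
  uniform (\<open>stretched_E8_covering\<close>).
\<close>

section \<open>The lattice\<close>

lemma E8_iff:
  "x \<in> E8 \<longleftrightarrow> ((\<forall>i. x $ i \<in> \<int>) \<or> (\<forall>i. x $ i - 1/2 \<in> \<int>)) \<and> (\<Sum>i\<in>UNIV. x $ i) / 2 \<in> \<int>"
proof -
  have "(\<exists>k::int. s = 2 * of_int k) \<longleftrightarrow> s / 2 \<in> \<int>" for s :: real
    by (auto simp: Ints_def image_iff field_simps)
  then show ?thesis by (simp add: E8_def)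
qed

lemma half_Ints_add:
  fixes r s :: real
  assumes "r - 1/2 \<in> \<int>" "s - 1/2 \<in> \<int>"
  shows "r + s \<in> \<int>"
  using Ints_add[OF Ints_add[OF assms] Ints_1] by simp

lemma E8_minus: "x \<in> E8 \<Longrightarrow> - x \<in> E8"
proof -
  have "- r - 1/2 \<in> \<int>" if "r - 1/2 \<in> \<int>" for r :: real
    using Ints_diff[OF Ints_minus[OF that] Ints_1] by (simp add: algebra_simps)
  moreover have "- (\<Sum>i\<in>UNIV. x $ i) / 2 \<in> \<int> \<longleftrightarrow> (\<Sum>i\<in>UNIV. x $ i) / 2 \<in> \<int>"
    using minus_in_Ints_iff[of "(\<Sum>i\<in>UNIV. x $ i) / 2"] by simp
  ultimately show "x \<in> E8 \<Longrightarrow> - x \<in> E8"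
    by (auto simp: E8_iff sum_negf)
qed

lemma E8_add:
  assumes "x \<in> E8" "y \<in> E8"
  shows "x + y \<in> E8"
proof -
  have mixed: "r + s - 1/2 \<in> \<int>" if "r \<in> \<int>" "s - 1/2 \<in> \<int>" for r s :: real
    using Ints_add[OF that] by (simp add: algebra_simps)
  have "(\<Sum>i\<in>UNIV. (x + y) $ i) / 2 \<in> \<int>"
    using Ints_add[of "(\<Sum>i\<in>UNIV. x $ i) / 2" "(\<Sum>i\<in>UNIV. y $ i) / 2"] assms
    by (simp add: E8_iff sum.distrib add_divide_distrib)
  moreover have "(\<forall>i. (x + y) $ i \<in> \<int>) \<or> (\<forall>i. (x + y) $ i - 1/2 \<in> \<int>)"
  proof -
    consider "\<forall>i. x $ i \<in> \<int>" "\<forall>i. y $ i \<in> \<int>" | "\<forall>i. x $ i \<in> \<int>" "\<forall>i. y $ i - 1/2 \<in> \<int>"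
      | "\<forall>i. x $ i - 1/2 \<in> \<int>" "\<forall>i. y $ i \<in> \<int>" | "\<forall>i. x $ i - 1/2 \<in> \<int>" "\<forall>i. y $ i - 1/2 \<in> \<int>"
      using assms unfolding E8_iff by blast
    then show ?thesis
    proof cases
      case 1
      then show ?thesis by simp
    next
      case 2
      then show ?thesis using mixed by simp
    next
      case 3
      then show ?thesis using mixed[of "y $ i" "x $ i" for i] by (simp add: add.commute)
    next
      case 4
      then show ?thesis using half_Ints_add by simp
    qed
  qed
  ultimately show ?thesis by (simp add: E8_iff)
qed

lemma E8_diff: "x \<in> E8 \<Longrightarrow> y \<in> E8 \<Longrightarrow> x - y \<in> E8"
  using E8_add[OF _ E8_minus] by simp

lemma half_vector_in_E8: "(\<chi> i. 1/2) \<in> E8"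
  by (simp add: E8_iff)

lemma norm_power2_sum: "(norm (x :: real^'n))\<^sup>2 = (\<Sum>i\<in>UNIV. (x $ i)\<^sup>2)"
  unfolding power2_norm_eq_inner by (simp add: inner_vec_def power2_eq_square)

lemma norm_diff_power2: "(norm (z - w))\<^sup>2 = (norm z)\<^sup>2 - 2 * (z \<bullet> w) + (norm w)\<^sup>2"
  by (simp add: power2_norm_eq_inner inner_diff_left inner_diff_right inner_commute)

lemma norm_diff_axis_power2:
  "(norm (d - axis i e :: real^'n))\<^sup>2 = (norm d)\<^sup>2 - 2 * e * d $ i + e\<^sup>2"
proof -
  have "(norm (axis i e :: real^'n))\<^sup>2 = e\<^sup>2"
    unfolding power2_norm_eq_inner by (simp add: inner_axis_axis power2_eq_square)
  then show ?thesis by (simp add: norm_diff_power2 inner_axis)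
qed

lemma odd_half_Ints:
  fixes s e :: real
  assumes "s \<in> \<int>" "s / 2 \<notin> \<int>" "\<bar>e\<bar> = 1"
  shows "(s + e) / 2 \<in> \<int>"
proof -
  obtain k where k: "s = of_int k" using assms(1) by (auto elim: Ints_cases)
  have "odd k"
  proof
    assume "even k"
    then obtain j where "k = 2 * j" by (auto elim: evenE)
    then show False using assms(2) k by simp
  qed
  then obtain j where j: "k = 2 * j + 1" by (auto elim: oddE)
  from assms(3) consider "e = 1" | "e = -1" by linarith
  then show ?thesis
  proof cases
    case 1
    then have "(s + e) / 2 = of_int (j + 1)" by (simp add: k j)
    then show ?thesis by (metis Ints_of_int)
  next
    case 2
    then have "(s + e) / 2 = of_int j" by (simp add: k j)
    then show ?thesis by (metis Ints_of_int)
  qed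
qed

text \<open>
  A point with the coordinates of a lattice point fails to be one only through the parity of
  its coordinate sum, and a unit step in any direction repairs the parity.
\<close>

lemma odd_shift_in_E8:
  fixes y :: "real^8"
  assumes "(\<forall>i. y $ i \<in> \<int>) \<or> (\<forall>i. y $ i - 1/2 \<in> \<int>)" "y \<notin> E8" "\<bar>e\<bar> = 1"
  shows "y + axis j e \<in> E8"
proof -
  have e: "e \<in> \<int>" using assms(3) by (cases "e \<ge> 0") (auto simp: abs_if split: if_splits)
  have sum_Ints: "(\<Sum>i\<in>UNIV. y $ i) \<in> \<int>"
  proof (rule disjE[OF assms(1)])
    assume "\<forall>i. y $ i - 1/2 \<in> \<int>"
    then have "(\<Sum>i\<in>UNIV. y $ i - 1/2) \<in> \<int>" by (intro Ints_sum) auto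
    then have "(\<Sum>i\<in>UNIV. y $ i) - 4 \<in> \<int>" by (simp add: sum_subtractf)
    then show ?thesis using Ints_add[of _ 4] by fastforce
  qed (auto intro: Ints_sum)
  have coord: "(y + axis j e) $ i = y $ i + (if i = j then e else 0)" for i
    by (simp add: axis_def)
  have eI: "(if i = j then e else 0) \<in> \<int>" for i using e by simp
  have "(\<Sum>i\<in>UNIV. (y + axis j e) $ i) = (\<Sum>i\<in>UNIV. y $ i) + e"
    by (simp only: coord sum.distrib) simp
  moreover have "((\<Sum>i\<in>UNIV. y $ i) + e) / 2 \<in> \<int>"
    using odd_half_Ints[OF sum_Ints _ assms(3)] assms(1,2) by (simp add: E8_iff)
  moreover have "(\<forall>i. (y + axis j e) $ i \<in> \<int>) \<or> (\<forall>i. (y + axis j e) $ i - 1/2 \<in> \<int>)"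
  proof -
    have "r + (if i = j then e else 0) - 1/2 \<in> \<int>" if "r - 1/2 \<in> \<int>" for r i
      using Ints_add[OF that eI[of i]] by (simp add: algebra_simps)
    then show ?thesis using assms(1) Ints_add[OF _ eI] unfolding coord by metis
  qed
  ultimately show ?thesis by (simp add: E8_iff)
qed

section \<open>Deep holes\<close>

text \<open>
  Since the covering radius will turn out to be \<open>1\<close>, these are exactly the deep holes.
\<close>

definition far_from_E8 :: "real^8 \<Rightarrow> bool" where
  "far_from_E8 x \<longleftrightarrow> (\<forall>v\<in>E8. 1 \<le> norm (x - v))"

lemma far_from_E8_translate:
  assumes "v \<in> E8"
  shows "far_from_E8 (x + v) \<longleftrightarrow> far_from_E8 x"
proof -
  have "far_from_E8 (y + w)" if "far_from_E8 y" "w \<in> E8" for y w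
    unfolding far_from_E8_def
  proof
    fix q assume "q \<in> E8"
    then have "1 \<le> norm (y - (q - w))"
      using that E8_diff unfolding far_from_E8_def by blast
    then show "1 \<le> norm (y + w - q)" by (simp add: algebra_simps)
  qed
  from this[of x v] this[of "x + v" "- v"] show ?thesis using assms E8_minus by auto
qed

lemma far_from_E8_power2: "far_from_E8 x \<Longrightarrow> v \<in> E8 \<Longrightarrow> 1 \<le> (norm (x - v))\<^sup>2"
  by (simp add: far_from_E8_def one_le_power)

text \<open>
  The coordinatewise rounding \<open>z\<close> of the point, or \<open>z\<close> with one coordinate rounded the other way, is
  a lattice point. Changing the rounding of coordinate \<open>i\<close> turns \<open>(norm d)\<^sup>2\<close> into
  \<open>(norm d)\<^sup>2 + 1 - 2 * \<bar>d $ i\<bar>\<close>. If \<open>z\<close> itself lies in the lattice, the bound is weaker than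
  \<open>1 \<le> (norm d)\<^sup>2\<close>, so the inequality holds for either parity.
\<close>

lemma far_rounding:
  fixes z d :: "real^8"
  assumes far: "far_from_E8 (z + d)" and z: "\<And>i. z $ i \<in> \<int>" and d: "\<And>i. \<bar>d $ i\<bar> \<le> 1/2"
  shows "2 * \<bar>d $ i\<bar> \<le> (norm d)\<^sup>2"
proof (cases "z \<in> E8")
  case True
  then have "1 \<le> (norm d)\<^sup>2" using far_from_E8_power2[OF far True] by simp
  then show ?thesis using d[of i] by linarith
next
  case False
  define e :: real where "e = (if d $ i \<ge> 0 then 1 else -1)"
  have "z + axis i e \<in> E8" by (rule odd_shift_in_E8) (use z False in \<open>auto simp: e_def\<close>)
  from far_from_E8_power2[OF far this] have "1 \<le> (norm (d - axis i e))\<^sup>2" by simp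
  also have "(norm (d - axis i e))\<^sup>2 = (norm d)\<^sup>2 + 1 - 2 * \<bar>d $ i\<bar>"
    by (simp add: norm_diff_axis_power2 e_def)
  finally show ?thesis by simp
qed

text \<open>
  Translation by the lattice vector with all coordinates \<open>1/2\<close> exchanges rounding to integers and
  rounding to half-integers. It lets facts about the first be reused for the second.
\<close>

lemma flipped_remainder:
  fixes z d :: "real^8"
  assumes "\<And>i. z $ i \<in> \<int>" "\<And>i. \<bar>d $ i\<bar> \<le> 1/2"
  obtains z' d' :: "real^8" where "z + d + (\<chi> i. 1/2) = z' + d'" "\<And>i. z' $ i \<in> \<int>"
    "\<And>i. \<bar>d' $ i\<bar> = 1/2 - \<bar>d $ i\<bar>"
proof
  define s :: "real^8" where "s = (\<chi> i. if d $ i \<ge> 0 then 1/2 else -1/2)"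
  show "z + d + (\<chi> i. 1/2) = (z + s + (\<chi> i. 1/2)) + (d - s)" by simp
  show "(z + s + (\<chi> i. 1/2)) $ i \<in> \<int>" for i using assms(1) by (simp add: s_def)
  show "\<bar>(d - s) $ i\<bar> = 1/2 - \<bar>d $ i\<bar>" for i using assms(2)[of i] by (auto simp: s_def)
qed

text \<open>
  Let \<open>m\<close> and \<open>M\<close> be the extreme values of \<open>a\<close>, and \<open>S1\<close> and \<open>S2\<close> the sums of its entries and of
  their squares. The hypotheses at \<open>M\<close> and \<open>m\<close> say that \<open>A = S2 - 2M\<close> and
  \<open>B = 1 + S2 - S1 + 2m\<close> are nonnegative. The convex combination of \<open>A\<close> and \<open>B\<close> with weights
  \<open>1 - m - M\<close> and \<open>m + M\<close> eliminates \<open>S1\<close> and \<open>S2\<close> once \<open>P = \<Sum>(a\<^sub>i - m)(M - a\<^sub>i)\<close> is added, and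
  what is left is \<open>-(M - m)(1 - 2(M - m))\<close>. So a sum of four nonnegative terms vanishes,
  which leaves the extremal configurations only.
\<close>

lemma remainder_dichotomy:
  fixes a :: "8 \<Rightarrow> real"
  assumes a: "\<And>i. 0 \<le> a i" "\<And>i. a i \<le> 1/2"
    and A: "\<And>i. 2 * a i \<le> (\<Sum>k\<in>UNIV. (a k)\<^sup>2)"
    and B: "\<And>i. 2 * (1/2 - a i) \<le> (\<Sum>k\<in>UNIV. (1/2 - a k)\<^sup>2)"
  shows "(\<exists>y\<in>{0, 1/4, 1/2}. \<forall>i. a i = y)
    \<or> (\<forall>i. a i = 0 \<or> a i = 1/2) \<and> (\<Sum>k\<in>UNIV. (a k)\<^sup>2) = 1"
proof -
  define S1 S2 where "S1 = (\<Sum>k\<in>UNIV. a k)" and "S2 = (\<Sum>k\<in>UNIV. (a k)\<^sup>2)"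
  obtain iM where iM: "\<And>i. a i \<le> a iM"
  proof -
    have "Max (range a) \<in> range a" by (intro Max_in) auto
    then show ?thesis using that by (metis Max_ge finite finite_imageI image_iff rangeI)
  qed
  obtain im where im: "\<And>i. a im \<le> a i"
  proof -
    have "Min (range a) \<in> range a" by (intro Min_in) auto
    then show ?thesis using that by (metis Min_le finite finite_imageI image_iff rangeI)
  qed
  define M m where "M = a iM" and "m = a im"
  have bnd: "0 \<le> m" "m \<le> M" "M \<le> 1/2" using a im by (auto simp: M_def m_def)
  have term_nonneg: "0 \<le> (a i - m) * (M - a i)" for i
    using iM im by (simp add: M_def m_def)
  define P where "P = (\<Sum>i\<in>UNIV. (a i - m) * (M - a i))"
  have P: "P = (m + M) * S1 - S2 - 8 * m * M"
  proof -
    have "(a i - m) * (M - a i) = (m + M) * a i - (a i)\<^sup>2 - m * M" for i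
      by (simp add: algebra_simps power2_eq_square)
    then show ?thesis by (simp add: P_def S1_def S2_def sum_subtractf sum_distrib_left)
  qed
  have "(\<Sum>k\<in>UNIV. (1/2 - a k)\<^sup>2) = 2 - S1 + S2"
    by (simp add: power2_diff sum.distrib sum_subtractf S1_def S2_def power_divide)
  then have B': "0 \<le> 1 + S2 - S1 + 2 * m" using B[of im] by (simp add: m_def)
  have A': "0 \<le> S2 - 2 * M" using A[of iM] by (simp add: M_def S2_def)
  have "P \<ge> 0" unfolding P_def by (intro sum_nonneg term_nonneg)
  moreover have "0 \<le> (1 - m - M) * (S2 - 2 * M)" using A' bnd by simp
  moreover have "0 \<le> (m + M) * (1 + S2 - S1 + 2 * m)" using B' bnd by simp
  moreover have "0 \<le> (M - m) * (1 - 2 * (M - m))" using bnd by simp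
  moreover have "(1 - m - M) * (S2 - 2 * M) + (m + M) * (1 + S2 - S1 + 2 * m) + P
      + (M - m) * (1 - 2 * (M - m)) = 0"
    unfolding P by (simp add: algebra_simps power2_eq_square)
  ultimately have zero: "P = 0" "(1 - m - M) * (S2 - 2 * M) = 0" "(M - m) * (1 - 2 * (M - m)) = 0"
    by linarith+
  show ?thesis
  proof (cases "M = m")
    case True
    then have eq: "a i = m" for i using iM im by (simp add: M_def m_def order_antisym)
    then have "S2 = 8 * m\<^sup>2" by (simp add: S2_def)
    then have "(1 - 2 * m) * (m * (4 * m - 1)) = 0"
      using zero(2) True by (simp add: algebra_simps power2_eq_square)
    then have "m \<in> {0, 1/4, 1/2}" by auto
    then show ?thesis using eq by blast
  next
    case False
    then have Mm: "M = 1/2" "m = 0" using zero(3) bnd by auto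
    have "\<forall>i\<in>UNIV. (a i - m) * (M - a i) = 0"
      using zero(1) term_nonneg unfolding P_def by (subst (asm) sum_nonneg_eq_0_iff) auto
    then have "\<forall>i. a i = 0 \<or> a i = 1/2" using Mm by force
    moreover have "S2 = 1" using zero(2) Mm by simp
    ultimately show ?thesis by (simp add: S2_def)
  qed
qed

text \<open>
  Here exactly four coordinates of \<open>d\<close> are \<open>\<plusminus>1/2\<close> and the others vanish. Such a point is
  the midpoint of the two lattice points obtained by rounding the four coordinates one way or all the
  other way, once the parity is right, and \<open>2 * d\<close> lies in \<open>E8\<close> because it has four odd entries. A
  wrong parity is mended by reversing the rounding of one of the four.
\<close>

lemma antipodal_of_half_remainder:
  fixes z d :: "real^8"
  assumes z: "\<And>i. z $ i \<in> \<int>" and d: "\<And>i. d $ i = 0 \<or> \<bar>d $ i\<bar> = 1/2"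
    and nd: "norm d = 1" and d1: "d $ 1 = 0"
  shows "\<exists>u. norm u = 1 \<and> \<bar>u $ 1\<bar> \<le> 1/4 \<and> z + d + u \<in> E8 \<and> z + d - u \<in> E8"
proof -
  have even: "y + d' + d' \<in> E8"
    if y: "y \<in> E8" "\<And>i. y $ i \<in> \<int>" and d': "\<And>i. d' $ i = 0 \<or> \<bar>d' $ i\<bar> = 1/2" "norm d' = 1"
    for y d' :: "real^8"
  proof -
    \<comment> \<open>As \<open>e\<close> and \<open>e\<^sup>2\<close> agree modulo \<open>2\<close> for the integers \<open>e = 2 d'\<^sub>i\<close>, the sum of \<open>d'\<close> differs by an
      integer from \<open>2 (norm d')\<^sup>2 = 2\<close>.\<close>
    have cong: "d' $ i - 2 * (d' $ i)\<^sup>2 \<in> \<int>" for i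
    proof -
      from d'(1)[of i] consider "d' $ i = 0" | "d' $ i = 1/2" | "d' $ i = -1/2" by linarith
      then have "d' $ i - 2 * (d' $ i)\<^sup>2 = 0 \<or> d' $ i - 2 * (d' $ i)\<^sup>2 = -1"
        by cases (simp_all only:, simp_all add: power2_eq_square)
      then show ?thesis by auto
    qed
    have "(\<Sum>i\<in>UNIV. d' $ i - 2 * (d' $ i)\<^sup>2) \<in> \<int>" by (intro Ints_sum cong)
    then have "(\<Sum>i\<in>UNIV. d' $ i) - 2 \<in> \<int>"
      using d'(2) norm_power2_sum[of d'] by (simp add: sum_subtractf flip: sum_distrib_left)
    then have "(\<Sum>i\<in>UNIV. d' $ i) \<in> \<int>" using Ints_add[of _ 2] by fastforce
    moreover have "(d' + d') $ i \<in> \<int>" for i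
    proof -
      from d'(1)[of i] consider "d' $ i = 0" | "d' $ i = 1/2" | "d' $ i = -1/2" by linarith
      then have "(d' + d') $ i = 0 \<or> (d' + d') $ i = 1 \<or> (d' + d') $ i = -1"
        by cases (simp_all only: vector_add_component, simp_all)
      then show ?thesis by auto
    qed
    moreover have "(\<Sum>i\<in>UNIV. (d' + d') $ i) / 2 = (\<Sum>i\<in>UNIV. d' $ i)"
      by (simp add: sum.distrib del: mult_2 flip: sum_distrib_left)
    ultimately have "d' + d' \<in> E8" unfolding E8_iff by metis
    then show ?thesis using E8_add[OF y(1)] by (simp add: add.assoc)
  qed
  show ?thesis
  proof (cases "z \<in> E8")
    case True
    then show ?thesis using even[OF True z d nd] nd d1 by (intro exI[of _ d]) simp
  next
    case False
    obtain i where i: "d $ i \<noteq> 0" using nd by (metis norm_zero vec_eq_iff zero_index zero_neq_one)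
    define e where "e = 2 * d $ i"
    have e: "\<bar>e\<bar> = 1" using d[of i] i by (simp add: e_def)
    define d' where "d' = d - axis i e"
    have abs_d': "\<bar>d' $ k\<bar> = \<bar>d $ k\<bar>" for k by (simp add: d'_def axis_def e_def)
    have "norm d' = 1"
      using nd unfolding norm_vec_def real_norm_def abs_d' .
    moreover have "d' $ k = 0 \<or> \<bar>d' $ k\<bar> = 1/2" for k using d[of k] abs_d'[of k] by linarith
    moreover have y: "z + axis i e \<in> E8" using z e False by (intro odd_shift_in_E8) auto
    moreover have "(z + axis i e) $ k \<in> \<int>" for k
    proof -
      have "e \<in> \<int>" using e by (auto simp: abs_if split: if_splits)
      then show ?thesis using z by (simp add: axis_def)
    qed
    moreover have "z + d = z + axis i e + d'" by (simp add: d'_def)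
    moreover have "\<bar>d' $ 1\<bar> = 0" using abs_d'[of 1] d1 by simp
    ultimately show ?thesis using even[of "z + axis i e" d'] by (intro exI[of _ d']) simp
  qed
qed

text \<open>
  Up to lattice translations, permutations of the coordinates and even numbers of sign changes,
  there are three kinds of points to consider, all of the form \<open>v/2\<close> for a lattice vector \<open>v\<close> of
  squared length \<open>4\<close>: half of \<open>(2, 0, \<dots>, 0)\<close>, of \<open>(1, 1, 1, 1, 0, 0, 0, 0)\<close> and of
  \<open>(-3/2, 1/2, \<dots>, 1/2)\<close>. A small first
  coordinate of \<open>u\<close> is obtained in the first kind from a unit vector along another axis, in the
  second from the vector supported on the four coordinates not of the type of the first one, and
  in the third by placing the entry \<open>\<plusminus>3/4\<close> outside the first coordinate.
\<close>

lemma deep_hole_antipodal: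
  assumes far: "far_from_E8 x"
  shows "\<exists>u. norm u = 1 \<and> \<bar>u $ 1\<bar> \<le> 1/4 \<and> x + u \<in> E8 \<and> x - u \<in> E8"
proof -
  define z d :: "real^8" where "z = (\<chi> i. of_int (round (x $ i)))" and "d = x - z"
  have x: "x = z + d" by (simp add: d_def)
  have z: "z $ i \<in> \<int>" for i by (simp add: z_def)
  have d: "\<bar>d $ i\<bar> \<le> 1/2" for i
    using of_int_round_abs_le[of "x $ i"] by (simp add: d_def z_def abs_minus_commute)
  obtain z' d' :: "real^8" where flip: "z + d + (\<chi> i. 1/2) = z' + d'" "\<And>i. z' $ i \<in> \<int>"
    "\<And>i. \<bar>d' $ i\<bar> = 1/2 - \<bar>d $ i\<bar>"
    using flipped_remainder[of z d] z d by blast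
  have norm_d': "(norm d')\<^sup>2 = (\<Sum>k\<in>UNIV. (1/2 - \<bar>d $ k\<bar>)\<^sup>2)"
    unfolding norm_power2_sum flip(3)[symmetric] by simp
  have norm_d: "(norm d)\<^sup>2 = (\<Sum>k\<in>UNIV. \<bar>d $ k\<bar>\<^sup>2)" by (simp add: norm_power2_sum)
  have far': "far_from_E8 (z' + d')"
    using far far_from_E8_translate[OF half_vector_in_E8] by (simp add: x flip flip: flip(1))
  have "2 * \<bar>d $ i\<bar> \<le> (norm d)\<^sup>2" for i using far_rounding far z d x by blast
  moreover have "2 * (1/2 - \<bar>d $ i\<bar>) \<le> (norm d')\<^sup>2" for i
    using far_rounding[OF far' flip(2), of i] flip(3) by simp
  ultimately have "(\<exists>y\<in>{0, 1/4, 1/2}. \<forall>i. \<bar>d $ i\<bar> = y)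
      \<or> (\<forall>i. \<bar>d $ i\<bar> = 0 \<or> \<bar>d $ i\<bar> = 1/2) \<and> (norm d)\<^sup>2 = 1"
    using remainder_dichotomy[of "\<lambda>i. \<bar>d $ i\<bar>"] d unfolding norm_d norm_d' by simp
  moreover have odd_point: ?thesis if x_coords: "(\<forall>i. x $ i \<in> \<int>) \<or> (\<forall>i. x $ i - 1/2 \<in> \<int>)"
  proof -
    have "x \<notin> E8" using far_from_E8_power2[OF far, of x] by auto
    then have "x + axis 2 1 \<in> E8" "x + axis 2 (-1) \<in> E8"
      using odd_shift_in_E8[OF x_coords] by simp_all
    moreover have "x + axis 2 (-1) = x - axis 2 1" by (simp add: axis_def vec_eq_iff)
    moreover have "(axis 2 1 :: real^8) $ 1 = 0" by (simp add: axis_def)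
    ultimately show ?thesis by (intro exI[of _ "axis 2 1"]) (simp add: norm_axis_1)
  qed
  ultimately consider (flat) "\<forall>i. \<bar>d $ i\<bar> = 0" | (all_half) "\<forall>i. \<bar>d $ i\<bar> = 1/2"
    | (quarter) "\<forall>i. \<bar>d $ i\<bar> = 1/4"
    | (mixed) "\<forall>i. \<bar>d $ i\<bar> = 0 \<or> \<bar>d $ i\<bar> = 1/2" "(norm d)\<^sup>2 = 1"
    by blast
  then show ?thesis
  proof cases
    case quarter
    have quarter': "d $ i = 1/4 \<or> d $ i = -1/4" for i using quarter[rule_format, of i] by linarith
    have nd: "(norm d)\<^sup>2 = 1/2" unfolding norm_d by (simp add: quarter power_divide)
    have "z \<notin> E8" using far_from_E8_power2[OF far, of z] nd by (auto simp: x)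
    define e where "e = 4 * d $ 2"
    have e: "\<bar>e\<bar> = 1" using quarter[rule_format, of 2] unfolding e_def by linarith
    \<comment> \<open>\<open>z\<close> and \<open>h\<close> are the nearest points with integer and with half-integer coordinates, and \<open>x\<close>
      is their midpoint; both have the wrong parity, and opposite unit steps correct it.\<close>
    define h where "h = z + d + d"
    have h: "h $ i - 1/2 \<in> \<int>" for i
    proof -
      have "h $ i - 1/2 = z $ i \<or> h $ i - 1/2 = z $ i - 1"
        using quarter'[of i] unfolding h_def vector_add_component by linarith
      then show ?thesis using z[of i] by auto
    qed
    have "h \<notin> E8" using far_from_E8_power2[OF far, of h] nd by (auto simp: x h_def)
    define u where "u = d - axis 2 e"
    have "\<bar>d $ 2\<bar>\<^sup>2 = (1/4)\<^sup>2" using quarter by (simp only:)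
    then have "(d $ 2)\<^sup>2 = 1/16" by (simp add: power_divide)
    then have "(norm u)\<^sup>2 = 1"
      using nd unfolding u_def norm_diff_axis_power2 by (simp add: e_def power2_eq_square)
    then have "norm u = 1" by (simp add: power2_eq_1_iff) (use norm_ge_zero[of u] in linarith)
    moreover have "\<bar>u $ 1\<bar> \<le> 1/4" using quarter by (simp add: u_def axis_def)
    moreover have "x - u \<in> E8"
      using odd_shift_in_E8[of z e 2] z \<open>z \<notin> E8\<close> e by (simp add: x u_def)
    moreover have "x + u \<in> E8"
    proof -
      have "x + u = h + axis 2 (- e)" by (simp add: x u_def h_def axis_def vec_eq_iff)
      then show ?thesis using odd_shift_in_E8[of h "- e" 2] h \<open>h \<notin> E8\<close> e by simp
    qed
    ultimately show ?thesis by blast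
  next
    case mixed
    then have nd: "norm d = 1" by (simp add: power2_eq_1_iff) (use norm_ge_zero[of d] in linarith)
    show ?thesis
    proof (cases "d $ 1 = 0")
      case True
      then show ?thesis
        using antipodal_of_half_remainder[of z d] z mixed nd by (simp add: x)
    next
      \<comment> \<open>Translating by the vector of halves exchanges the zeros of \<open>d\<close> with the entries \<open>\<plusminus>1/2\<close>.\<close>
      case False
      then have d1: "d' $ 1 = 0" using mixed(1) flip(3)[of 1] by fastforce
      have half': "d' $ i = 0 \<or> \<bar>d' $ i\<bar> = 1/2" for i
        using mixed(1)[rule_format, of i] flip(3)[of i] by auto
      have "(1/2 - \<bar>d $ k\<bar>)\<^sup>2 = 1/4 - \<bar>d $ k\<bar>\<^sup>2" for k
        by (rule disjE[OF mixed(1)[rule_format, of k]]) (simp_all only:, simp_all add: power2_eq_square)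
      then have "(norm d')\<^sup>2 = 1"
        using mixed(2) by (simp add: norm_d norm_d' sum_subtractf)
      then have "norm d' = 1" by (simp add: power2_eq_1_iff) (use norm_ge_zero[of d'] in linarith)
      then obtain u where u: "norm u = 1" "\<bar>u $ 1\<bar> \<le> 1/4" "z' + d' + u \<in> E8" "z' + d' - u \<in> E8"
        using antipodal_of_half_remainder[of z' d'] flip(2) half' d1 by blast
      have "x + u = z' + d' + u - (\<chi> i. 1/2)" "x - u = z' + d' - u - (\<chi> i. 1/2)"
        by (simp_all add: x flip: flip(1))
      then show ?thesis using u E8_diff half_vector_in_E8 by metis
    qed
  next
    case flat
    then have "d = 0" by (simp add: vec_eq_iff)
    then show ?thesis using odd_point z by (simp add: x)
  next
    case all_half
    have "x $ i - 1/2 \<in> \<int>" for i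
    proof -
      have "x $ i - 1/2 = z $ i \<or> x $ i - 1/2 = z $ i - 1"
        using all_half[rule_format, of i] unfolding x vector_add_component by linarith
      then show ?thesis using z[of i] by auto
    qed
    then show ?thesis using odd_point by blast
  qed
qed

corollary E8_covering_radius: "\<exists>v\<in>E8. norm (x - v) \<le> 1"
proof (rule ccontr)
  assume "\<not> ?thesis"
  then have gt: "\<And>v. v \<in> E8 \<Longrightarrow> 1 < norm (x - v)" by force
  then have "far_from_E8 x" by (auto simp: far_from_E8_def intro: less_imp_le)
  then obtain u where "norm u = 1" "x - u \<in> E8" using deep_hole_antipodal by blast
  then show False using gt[of "x - u"] by simp
qed

lemma far_from_E8_axis: "far_from_E8 (axis j 1)"
  unfolding far_from_E8_def
proof
  fix v assume v: "v \<in> E8"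
  have "1 \<le> (norm (axis j 1 - v))\<^sup>2"
  proof (cases "\<forall>i. v $ i \<in> \<int>")
    case True
    have "axis j 1 - v \<noteq> 0"
    proof
      assume "axis j 1 - v = 0"
      then have "v = axis j 1" by simp
      then have "(\<Sum>i\<in>UNIV. v $ i) = 1" by (simp add: axis_def)
      then have "(1 / 2 :: real) \<in> \<int>" using v by (simp add: E8_iff)
      then obtain k :: int where "1 / 2 = real_of_int k" by (auto elim: Ints_cases)
      then have "real_of_int (2 * k) = real_of_int 1" by simp
      then have "2 * k = 1" by (simp only: of_int_eq_iff)
      then show False by presburger
    qed
    then obtain i where i: "(axis j 1 - v) $ i \<noteq> 0" by (metis vec_eq_iff zero_index)
    have "(axis j 1 - v) $ i \<in> \<int>" using True by (simp add: axis_def)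
    then have "1 \<le> \<bar>(axis j 1 - v) $ i\<bar>" using i Ints_nonzero_abs_ge1 by blast
    also have "\<dots> \<le> norm (axis j 1 - v)" by (rule component_le_norm_cart)
    finally show ?thesis by (simp add: one_le_power)
  next
    case False
    then have half: "\<forall>i. v $ i - 1/2 \<in> \<int>" using v unfolding E8_iff by blast
    have "1/4 \<le> ((axis j 1 - v) $ i)\<^sup>2" for i
    proof -
      have "axis j 1 $ i - (v $ i - 1/2) \<in> (\<int> :: real set)"
        using half by (intro Ints_diff[of "axis j 1 $ i"]) (auto simp: axis_def)
      then obtain k :: int where "axis j 1 $ i - (v $ i - 1/2) = real_of_int k"
        by (auto elim: Ints_cases)
      then have k: "(axis j 1 - v) $ i = real_of_int k - 1/2" by simp
      have "real_of_int k \<le> 0 \<or> real_of_int k \<ge> 1" by (cases "k \<le> 0") auto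
      then have "(1/2)\<^sup>2 \<le> \<bar>(axis j 1 - v) $ i\<bar>\<^sup>2"
        unfolding k by (intro power_mono) auto
      then show ?thesis by (simp add: power2_eq_square)
    qed
    then have "(\<Sum>i\<in>(UNIV::8 set). 1/4) \<le> (norm (axis j 1 - v))\<^sup>2"
      unfolding norm_power2_sum by (intro sum_mono) auto
    then show ?thesis by simp
  qed
  then show "1 \<le> norm (axis j 1 - v)"
    using power2_le_imp_le[of 1 "norm (axis j 1 - v)"] by simp
qed

section \<open>Stretching the lattice\<close>

text \<open>
  The left-hand side is the squared length of \<open>x - v\<close> after stretching. The constant \<open>1/10\<close> may be
  any number strictly between \<open>1/16\<close>, the bound on \<open>u\<^sub>1\<^sup>2\<close>, and \<open>1/8\<close>, the growth rate of the
  eighth root of the determinant.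
\<close>

definition covered :: "real \<Rightarrow> real^8 \<Rightarrow> bool" where
  "covered t x \<longleftrightarrow> (\<exists>v\<in>E8. (norm (x - v))\<^sup>2 + t * ((x - v) $ 1)\<^sup>2 \<le> 1 + t / 10)"

text \<open>
  Vectors in \<open>(1/2)E8\<close> have coordinates in \<open>(1/4)\<int>\<close>, so their squared lengths lie in \<open>(1/16)\<int>\<close>, and
  \<open>(51/50)\<^sup>2 < 17/16\<close>.
\<close>

lemma half_E8_norm_gap:
  assumes "2 *\<^sub>R w \<in> E8" "1 \<le> norm w" "norm w \<le> 51/50"
  shows "norm w = 1"
proof -
  have "2 * w $ i \<in> \<int> \<or> 2 * w $ i - 1/2 \<in> \<int>" for i
    using assms(1) unfolding E8_iff by auto
  then have "2 * w $ i + 2 * w $ i \<in> \<int>" for i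
    using half_Ints_add Ints_add by blast
  then have four: "4 * w $ i \<in> \<int>" for i by (metis distrib_right numeral_Bit0)
  have "(\<Sum>i\<in>UNIV. (4 * w $ i)\<^sup>2) \<in> \<int>" by (intro Ints_sum Ints_power four)
  moreover have "(\<Sum>i\<in>UNIV. (4 * w $ i)\<^sup>2) = 16 * (norm w)\<^sup>2"
    by (simp add: norm_power2_sum sum_distrib_left power_mult_distrib)
  ultimately obtain k :: int where k: "16 * (norm w)\<^sup>2 = real_of_int k" by (auto elim: Ints_cases)
  have "(norm w)\<^sup>2 \<le> (51/50)\<^sup>2" using assms(3) by (intro power_mono) auto
  then have "real_of_int k < 17" using k by (simp add: power2_eq_square)
  moreover have "real_of_int k \<ge> 16" using one_le_power[OF assms(2), of 2] k by simp
  ultimately have "k = 16" by linarith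
  then have "(norm w)\<^sup>2 = 1" using k by simp
  then show ?thesis using norm_ge_zero[of w] by (simp add: power2_eq_1_iff)
qed

text \<open>
  The distance to the lattice decreases at a definite rate in every direction away from a deep
  hole \<open>x\<close>, because \<open>x\<close> maximizes this distance. As the covering radius is \<open>1\<close>, the point \<open>x + y\<close>, with \<open>y\<close> the
  multiple of \<open>z\<close> of length \<open>1/50\<close>, has a lattice point \<open>v\<close> within distance \<open>1\<close>. By the gap in the
  lengths, \<open>v\<close> has distance exactly \<open>1\<close> from \<open>x\<close>, so \<open>norm (y - (v - x)) \<le> 1\<close> expands to
  \<open>(norm y)\<^sup>2 \<le> 2 * (y \<bullet> (v - x))\<close>. This bound is scaled back to \<open>z\<close>.
\<close>

lemma deep_hole_descent:
  assumes far: "far_from_E8 x" and x2: "2 *\<^sub>R x \<in> E8"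
  shows "\<exists>v\<in>E8. norm (v - x) = 1 \<and> norm z / 100 \<le> z \<bullet> (v - x)"
proof (cases "z = 0")
  case True
  obtain v where "v \<in> E8" "norm (x - v) \<le> 1" using E8_covering_radius by blast
  then have "norm (v - x) = 1" using far by (auto simp: far_from_E8_def norm_minus_commute)
  then show ?thesis using True \<open>v \<in> E8\<close> by auto
next
  case False
  define y where "y = (1 / (50 * norm z)) *\<^sub>R z"
  have ny: "norm y = 1/50" using False by (simp add: y_def)
  obtain v where v: "v \<in> E8" "norm (x + y - v) \<le> 1" using E8_covering_radius by blast
  define w where "w = v - x"
  have "norm w \<le> norm (w - y) + norm y" using norm_triangle_ineq[of "w - y" y] by simp
  also have "norm (w - y) = norm (x + y - v)"
    using norm_minus_commute[of "w - y" 0] by (simp add: w_def algebra_simps)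
  finally have "norm w \<le> 51/50" using v(2) ny by simp
  moreover have "1 \<le> norm w" using far v(1) by (simp add: far_from_E8_def w_def norm_minus_commute)
  moreover have "2 *\<^sub>R w \<in> E8"
    using E8_diff[OF E8_add[OF v(1) v(1)] x2] by (simp add: w_def algebra_simps scaleR_2)
  ultimately have nw: "norm w = 1" by (intro half_E8_norm_gap)
  have "(norm (y - w))\<^sup>2 \<le> 1"
    using v(2) by (simp add: w_def algebra_simps power_le_one)
  also have "(norm (y - w))\<^sup>2 = (norm y)\<^sup>2 - 2 * (y \<bullet> w) + (norm w)\<^sup>2"
    by (rule norm_diff_power2)
  finally have "1 / 5000 \<le> y \<bullet> w" using nw ny by (simp add: power2_eq_square)
  also have "y \<bullet> w = (z \<bullet> w) / (50 * norm z)" by (simp add: y_def)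
  finally have "norm z / 100 \<le> z \<bullet> w" using False by (simp add: field_simps)
  then show ?thesis using v(1) nw unfolding w_def by blast
qed

text \<open>
  If \<open>z\<close> is long compared with \<open>t\<close>, the linear gain from \<open>deep_hole_descent\<close>, at least
  \<open>norm z / 100 \<ge> 4 * t\<close> after the quadratic term is paid for, outweighs the cost \<open>4 * t\<close> of
  the stretch. Otherwise \<open>norm z = O(t)\<close>, and the vertex \<open>x + u\<close> or \<open>x - u\<close> on the
  side of \<open>z\<close> has stretched squared distance at most \<open>1 + t/16 + O(t\<^sup>2)\<close> from \<open>x + z\<close>. The
  bound \<open>1 / 10^7\<close> only serves to push the \<open>O(t\<^sup>2)\<close>, dominated by \<open>(400 * t)\<^sup>2\<close>, below \<open>t / 50\<close>.
\<close>

lemma covered_near_deep_hole: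
  assumes far: "far_from_E8 x" and z: "norm z \<le> 1/100" and t: "0 < t" "t \<le> 1 / 10^7"
  shows "covered t (x + z)"
proof -
  obtain u where u: "norm u = 1" "\<bar>u $ 1\<bar> \<le> 1/4" "x + u \<in> E8" "x - u \<in> E8"
    using deep_hole_antipodal[OF far] by blast
  have x2: "2 *\<^sub>R x \<in> E8" using E8_add[OF u(3,4)] by (simp add: scaleR_2)
  show ?thesis
  proof (cases "400 * t \<le> norm z")
    case True
    obtain v where v: "v \<in> E8" "norm (v - x) = 1" "norm z / 100 \<le> z \<bullet> (v - x)"
      using deep_hole_descent[OF far x2] by blast
    have diff: "x + z - v = z - (v - x)" by simp
    have "\<bar>(x + z - v) $ 1\<bar> \<le> norm (z - (v - x))"
      unfolding diff by (rule component_le_norm_cart)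
    also have "\<dots> \<le> norm z + norm (v - x)" by (rule norm_triangle_ineq4)
    also have "\<dots> \<le> 2" using z v(2) by simp
    finally have "((x + z - v) $ 1)\<^sup>2 \<le> 2\<^sup>2" by (rule power2_le_iff_abs_le[THEN iffD2, rotated]) simp
    then have "t * ((x + z - v) $ 1)\<^sup>2 \<le> t * 4" using t by (intro mult_left_mono) auto
    moreover have "(norm z)\<^sup>2 \<le> norm z / 100"
      using mult_left_mono[OF z norm_ge_zero[of z]] by (simp add: power2_eq_square)
    moreover have "(norm (x + z - v))\<^sup>2 \<le> (norm z)\<^sup>2 - norm z / 50 + 1"
      unfolding diff norm_diff_power2[of z] using v by simp
    ultimately have "(norm (x + z - v))\<^sup>2 + t * ((x + z - v) $ 1)\<^sup>2 \<le> 1 + t / 10"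
      using True t by linarith
    then show ?thesis using v(1) unfolding covered_def by blast
  next
    case False
    obtain w where w: "norm w = 1" "\<bar>w $ 1\<bar> \<le> 1/4" "x + w \<in> E8" "0 \<le> z \<bullet> w"
    proof (cases "0 \<le> z \<bullet> u")
      case True
      then show ?thesis using that u by blast
    next
      case False
      then show ?thesis using that[of "- u"] u by simp
    qed
    have "\<bar>z $ 1\<bar> \<le> 400 * t" using component_le_norm_cart[of z 1] False by linarith
    then have "\<bar>(z - w) $ 1\<bar> \<le> 1/4 + 400 / 10^7"
      using w(2) t unfolding vector_minus_component by linarith
    then have "((z - w) $ 1)\<^sup>2 \<le> (1/4 + 400 / 10^7)\<^sup>2"
      by (rule power2_le_iff_abs_le[THEN iffD2, rotated]) simp
    also have "\<dots> \<le> 7/100" by (simp add: power2_eq_square)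
    finally have "t * ((z - w) $ 1)\<^sup>2 \<le> t * (7/100)" using t by (intro mult_left_mono) auto
    moreover have "(norm z)\<^sup>2 \<le> (400 * t)\<^sup>2" using False by (intro power_mono) auto
    moreover have "(400 * t)\<^sup>2 \<le> 2/100 * t"
      using mult_left_mono[OF t(2), of "160000 * t"] t(1) by (simp add: power2_eq_square)
    moreover have "(norm (z - w))\<^sup>2 \<le> (norm z)\<^sup>2 + 1"
      unfolding norm_diff_power2 using w by simp
    ultimately have "(norm (z - w))\<^sup>2 + t * ((z - w) $ 1)\<^sup>2 \<le> 1 + t / 10"
      using t by linarith
    moreover have "x + z - (x + w) = z - w" by simp
    ultimately show ?thesis using w(3) unfolding covered_def by metis
  qed
qed

lemma covered_locally:
  "\<exists>r>0. \<forall>x\<in>ball c r. \<forall>t. 0 < t \<and> t < r \<longrightarrow> covered t x"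
proof (cases "far_from_E8 c")
  case True
  have "covered t x" if "x \<in> ball c (1 / 10^7)" "0 < t" "t < 1 / 10^7" for x t
    using covered_near_deep_hole[OF True, of "x - c" t] that
    by (simp add: dist_norm norm_minus_commute)
  then show ?thesis by (intro exI[of _ "1 / 10^7"]) auto
next
  case False
  then obtain v where v: "v \<in> E8" "norm (c - v) < 1" by (auto simp: far_from_E8_def not_le)
  define r where "r = (1 - norm (c - v)) / 2"
  have "covered t x" if x: "x \<in> ball c r" and t: "0 < t" "t < r" for x t
  proof -
    have "norm (x - v) \<le> norm (x - c) + norm (c - v)" using norm_triangle_ineq[of "x - c" "c - v"] by simp
    then have n: "norm (x - v) \<le> 1 - r"
      using x by (simp add: dist_norm norm_minus_commute r_def field_simps)
    have "(norm (x - v))\<^sup>2 \<le> norm (x - v) * 1"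
      unfolding power2_eq_square using n t by (intro mult_left_mono) auto
    moreover have "((x - v) $ 1)\<^sup>2 \<le> 1"
      using component_le_norm_cart[of "x - v" 1] n t by (simp add: abs_square_le_1)
    then have "t * ((x - v) $ 1)\<^sup>2 \<le> t" using t by (simp add: mult_left_le)
    ultimately have "(norm (x - v))\<^sup>2 + t * ((x - v) $ 1)\<^sup>2 \<le> 1 + t / 10"
      using n t by linarith
    then show ?thesis using v(1) unfolding covered_def by blast
  qed
  moreover have "r > 0" using v by (simp add: r_def)
  ultimately show ?thesis by blast
qed

lemma covered_translate:
  assumes "v \<in> E8" "covered t (x - v)"
  shows "covered t x"
proof -
  from assms(2) obtain w where "w \<in> E8"
    "(norm (x - v - w))\<^sup>2 + t * ((x - v - w) $ 1)\<^sup>2 \<le> 1 + t / 10"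
    unfolding covered_def by blast
  moreover have "x - v - w = x - (v + w)" by simp
  ultimately show ?thesis using E8_add[OF assms(1)] unfolding covered_def by metis
qed

proposition stretched_E8_covering:
  "\<exists>r>0. \<forall>t x. 0 < t \<and> t < r \<longrightarrow> covered t x"
proof -
  define C where "C = cbox (0 :: real^8) (\<chi> i. 2)"
  obtain r where r: "\<And>c. r c > 0" "\<And>c x t. x \<in> ball c (r c) \<Longrightarrow> 0 < t \<Longrightarrow> t < r c \<Longrightarrow> covered t x"
    using covered_locally by metis
  have "compact C" by (simp add: C_def compact_cbox)
  moreover have "C \<subseteq> (\<Union>c\<in>C. ball c (r c))" using r(1) by auto
  ultimately obtain D where D: "D \<subseteq> C" "finite D" "C \<subseteq> (\<Union>c\<in>D. ball c (r c))"
    using compactE_image[of C C "\<lambda>c. ball c (r c)"] by (metis open_ball)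
  define q where "q = Min (insert 1 (r ` D))"
  have q: "q > 0" "\<And>c. c \<in> D \<Longrightarrow> q \<le> r c" using D(2) r(1) by (auto simp: q_def)
  have "covered t x" if t: "0 < t" "t < q" for t x
  proof -
    \<comment> \<open>\<open>E8\<close> contains all vectors with even coordinates, so the cube \<open>C\<close> represents all points.\<close>
    define v :: "real^8" where "v = (\<chi> i. 2 * of_int \<lfloor>x $ i / 2\<rfloor>)"
    have "v \<in> E8" by (auto simp: E8_iff v_def simp flip: sum_distrib_left intro: Ints_sum)
    have "0 \<le> x $ i - 2 * of_int \<lfloor>x $ i / 2\<rfloor>" "x $ i - 2 * of_int \<lfloor>x $ i / 2\<rfloor> \<le> 2" for i
      by linarith+
    then have "x - v \<in> C" by (simp add: C_def mem_box_cart v_def)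
    then obtain c where "c \<in> D" "x - v \<in> ball c (r c)" using D(3) by auto
    then have "covered t (x - v)" using r(2) q(2) t by fastforce
    then show ?thesis using covered_translate \<open>v \<in> E8\<close> by blast
  qed
  then show ?thesis using q(1) by blast
qed

section \<open>Covering density\<close>

text \<open>
  This is \<open>A\<^sup>t D A\<close> with \<open>D\<close> diagonal, having \<open>1 + t\<close> in position \<open>k\<close> and \<open>1\<close> elsewhere, written
  as a rank one perturbation so that it visibly depends affinely on \<open>t\<close>.
\<close>

definition stretch :: "real^'d^'d \<Rightarrow> real \<Rightarrow> 'd \<Rightarrow> real^'d^'d" where
  "stretch A t k = transpose A ** A + t *\<^sub>R (\<chi> i j. A $ k $ i * A $ k $ j)"

lemma inner_transpose_mult: "x \<bullet> ((transpose A ** A) *v y) = (A *v x) \<bullet> (A *v (y :: real^'d))"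
  for A :: "real^'d^'d"
  by (metis dot_lmul_matrix matrix_vector_mul_assoc transpose_matrix_vector transpose_transpose inner_commute)

lemma quad_form_stretch:
  fixes A :: "real^'d^'d"
  shows "quad_form (stretch A t k) x = (norm (A *v x))\<^sup>2 + t * ((A *v x) $ k)\<^sup>2"
proof -
  have outer: "(\<chi> i j. A $ k $ i * A $ k $ j) *v x = ((A *v x) $ k) *\<^sub>R (A $ k)"
    by (simp add: matrix_vector_mult_def vec_eq_iff sum_distrib_left sum_distrib_right mult_ac)
  have "x \<bullet> (A $ k) = (A *v x) $ k"
    by (simp add: matrix_vector_mult_def inner_vec_def mult.commute)
  then show ?thesis
    by (simp add: quad_form_def stretch_def matrix_vector_mult_add_rdistrib inner_add_right
        inner_transpose_mult power2_norm_eq_inner outer flip: scaleR_matrix_vector_assoc)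
      (simp add: power2_eq_square)
qed

lemma stretch_pqf:
  fixes A :: "real^'d^'d"
  assumes "invertible A" "0 \<le> t"
  shows "stretch A t k \<in> pqfs"
proof -
  have "transpose (stretch A t k) = stretch A t k"
    by (simp add: stretch_def transpose_def matrix_matrix_mult_def vec_eq_iff mult.commute)
  moreover have "quad_form (stretch A t k) x > 0" if "x \<noteq> 0" for x
  proof -
    have "A *v x \<noteq> 0" using assms(1) that by (metis invertible_def matrix_left_invertible_ker)
    then show ?thesis using assms(2) by (simp add: quad_form_stretch add_pos_nonneg)
  qed
  ultimately show ?thesis by (simp add: pqfs_def sym_forms_def)
qed

lemma det_stretch:
  fixes A :: "real^'d^'d"
  shows "det (stretch A t k) = (1 + t) * (det A)\<^sup>2"
proof -
  define D :: "real^'d^'d" where "D = (\<chi> i j. if i = j then (if i = k then 1 + t else 1) else 0)"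
  have DA: "(D ** A) $ i $ j = A $ i $ j + (if i = k then t * A $ i $ j else 0)" for i j
  proof -
    have "D $ i $ l * A $ l $ j = (if l = i then (if i = k then 1 + t else 1) * A $ i $ j else 0)" for l
      by (simp add: D_def)
    then have "(D ** A) $ i $ j = (if i = k then 1 + t else 1) * A $ i $ j"
      by (simp add: matrix_matrix_mult_def)
    then show ?thesis by (simp add: distrib_right)
  qed
  have "(transpose A ** (D ** A)) $ i $ j = stretch A t k $ i $ j" for i j
  proof -
    have "(transpose A ** (D ** A)) $ i $ j = (\<Sum>l\<in>UNIV. A $ l $ i * (D ** A) $ l $ j)"
      unfolding matrix_matrix_mult_def[of "transpose A"] by (simp add: transpose_def)
    also have "\<dots> = (\<Sum>l\<in>UNIV. A $ l $ i * A $ l $ j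
        + (if l = k then t * (A $ k $ i * A $ k $ j) else 0))"
      by (intro sum.cong) (auto simp: DA algebra_simps)
    also have "\<dots> = stretch A t k $ i $ j"
      by (simp add: sum.distrib stretch_def matrix_matrix_mult_def transpose_def)
    finally show ?thesis .
  qed
  then have "stretch A t k = transpose A ** (D ** A)" by (simp add: vec_eq_iff)
  moreover have "det D = (\<Prod>i\<in>UNIV. D $ i $ i)" by (rule det_diagonal) (simp add: D_def)
  moreover have "\<dots> = 1 + t" by (simp add: D_def)
  ultimately show ?thesis by (simp add: det_mul det_transpose power2_eq_square)
qed

lemma stretch_in_neighborhood:
  fixes A :: "real^'d^'d"
  assumes "pqf_neighborhood U (transpose A ** A)" "invertible A"
  shows "\<exists>e>0. \<forall>t. 0 \<le> t \<and> t < e \<longrightarrow> stretch A t k \<in> U"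
proof -
  obtain V where V: "openin (top_of_set pqfs) V" "transpose A ** A \<in> V" "V \<subseteq> U"
    using assms(1) unfolding pqf_neighborhood_def by blast
  then obtain e where e: "e > 0" "ball (transpose A ** A) e \<inter> pqfs \<subseteq> V"
    by (meson openin_contains_ball)
  define B :: "real^'d^'d" where "B = (\<chi> i j. A $ k $ i * A $ k $ j)"
  have "stretch A t k \<in> U" if t: "0 \<le> t" "t < e / (norm B + 1)" for t
  proof -
    have "t * norm B \<le> t * (norm B + 1)" using t by (intro mult_left_mono) auto
    also have "\<dots> < e" using t(2) by (simp add: pos_less_divide_eq add_nonneg_pos)
    finally have "stretch A t k \<in> ball (transpose A ** A) e"
      using t(1) by (simp add: stretch_def dist_norm flip: B_def)
    then show ?thesis using stretch_pqf[OF assms(2) t(1)] e(2) V(3) by blast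
  qed
  moreover have "e / (norm B + 1) > 0" using e(1) by (simp add: add_nonneg_pos)
  ultimately show ?thesis by blast
qed

lemma inhom_min_leI:
  assumes "Q \<in> pqfs" "\<And>x. \<exists>v\<in>int_vecs. quad_form Q (x - v) \<le> b"
  shows "inhom_min Q \<le> b"
proof -
  obtain x where "inhom_min Q = (INF v\<in>int_vecs. quad_form Q (x - v))"
    using inhom_min_attained[OF assms(1)] by blast
  then show ?thesis
    using inhom_min_inner_attained[OF assms(1), of x] assms(2)[of x] by force
qed

lemma inhom_min_geI:
  assumes "Q \<in> pqfs" "\<And>v. v \<in> int_vecs \<Longrightarrow> b \<le> quad_form Q (x - v)"
  shows "b \<le> inhom_min Q"
proof -
  have "b \<le> (INF v\<in>int_vecs. quad_form Q (x - v))"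
    using inhom_min_inner_attained[OF assms(1), of x] assms(2) by force
  also have "\<dots> \<le> inhom_min Q"
    using inhom_min_attained[OF assms(1)] by metis
  finally show ?thesis .
qed

text \<open>
  The left-hand side grows with slope \<open>8/10 < 1\<close>. Each of three squarings slightly more than
  doubles the coefficient of \<open>t\<close>: \<open>1/10, 21/100, 43/100, 9/10\<close>.
\<close>

lemma one_plus_tenth_power8:
  fixes t :: real
  assumes "0 < t" "t \<le> 1/10"
  shows "(1 + t / 10) ^ 8 < 1 + t"
proof -
  have step: "(1 + a * t)\<^sup>2 \<le> 1 + b * t" if "0 \<le> a" "2 * a + a\<^sup>2 / 10 \<le> b" for a b
  proof -
    have "t * t * a\<^sup>2 \<le> t * (1/10) * a\<^sup>2" using assms by (intro mult_right_mono mult_left_mono) auto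
    moreover have "t * (2 * a + a\<^sup>2 / 10) \<le> t * b" using assms that by (intro mult_left_mono) auto
    ultimately show ?thesis by (simp add: power2_eq_square algebra_simps)
  qed
  have "(1 + t / 10) ^ 8 = (((1 + 1/10 * t)\<^sup>2)\<^sup>2)\<^sup>2" by simp
  also have "\<dots> \<le> (((1 + 21/100 * t))\<^sup>2)\<^sup>2"
    using assms by (intro power_mono step) (auto simp: power2_eq_square)
  also have "\<dots> \<le> (1 + 43/100 * t)\<^sup>2"
    using assms by (intro power_mono step) (auto simp: power2_eq_square)
  also have "\<dots> \<le> 1 + 9/10 * t" by (intro step) (auto simp: power2_eq_square)
  also have "\<dots> < 1 + t" using assms by simp
  finally show ?thesis .
qed

text \<open>
  The unit vector along the first axis is a deep hole, so the squared covering radius of \<open>E8\<close> is at least \<open>1\<close>; its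
  stretched counterpart has an eighth power below \<open>1 + t\<close>, the ratio of the determinants.
\<close>

lemma covering_density_stretch_less:
  fixes A :: "real^8^8"
  assumes basis: "is_basis_matrix A E8" and t: "0 < t" "t \<le> 1/10" and cov: "\<And>x. covered t x"
  shows "covering_density (stretch A t 1) < covering_density (transpose A ** A)"
proof -
  have inv: "invertible A" and E8: "E8 = (\<lambda>z. A *v z) ` int_vecs"
    using basis by (auto simp: is_basis_matrix_def)
  define d where "d = (det A)\<^sup>2"
  have d: "d > 0" using inv by (simp add: d_def invertible_det_nz)
  have Q0: "transpose A ** A = stretch A 0 1" by (simp add: stretch_def)
  have pqf: "stretch A 0 1 \<in> pqfs" "stretch A t 1 \<in> pqfs" using stretch_pqf[OF inv] t by simp_all
  have lower: "1 \<le> inhom_min (stretch A 0 1)"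
  proof -
    obtain B where B: "A ** B = mat 1" using inv by (auto simp: invertible_def)
    have "1 \<le> quad_form (stretch A 0 1) (B *v axis 1 1 - v)" if "v \<in> int_vecs" for v
    proof -
      have "A *v (B *v axis 1 1 - v) = axis 1 1 - A *v v"
        by (simp add: matrix_vector_mult_diff_distrib matrix_vector_mul_assoc B)
      moreover have "1 \<le> (norm (axis 1 1 - A *v v))\<^sup>2"
        using that E8 by (intro far_from_E8_power2[OF far_from_E8_axis]) blast
      ultimately show ?thesis by (simp add: quad_form_stretch)
    qed
    then show ?thesis using inhom_min_geI[OF pqf(1)] by blast
  qed
  have upper: "inhom_min (stretch A t 1) \<le> 1 + t / 10"
  proof (rule inhom_min_leI[OF pqf(2)])
    fix x
    have "\<exists>z\<in>int_vecs.
        (norm (A *v x - A *v z))\<^sup>2 + t * ((A *v x - A *v z) $ 1)\<^sup>2 \<le> 1 + t / 10"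
      using cov[of "A *v x"] unfolding covered_def E8 by blast
    then show "\<exists>v\<in>int_vecs. quad_form (stretch A t 1) (x - v) \<le> 1 + t / 10"
      by (auto simp: quad_form_stretch matrix_vector_mult_diff_distrib)
  qed
  have "0 \<le> inhom_min (stretch A t 1)"
    using pqf_nonneg[OF pqf(2)] by (intro inhom_min_geI[OF pqf(2)])
  then have "inhom_min (stretch A t 1) ^ 8 \<le> (1 + t / 10) ^ 8" using upper by (intro power_mono)
  also have "\<dots> < 1 + t" by (rule one_plus_tenth_power8[OF t])
  also have "\<dots> \<le> (1 + t) * inhom_min (stretch A 0 1) ^ 8" using one_le_power[OF lower] t by simp
  finally have "inhom_min (stretch A t 1) ^ 8 / ((1 + t) * d) < inhom_min (stretch A 0 1) ^ 8 / d"
    using t d by (simp add: divide_simps mult_ac)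
  then show ?thesis
    unfolding covering_density_def Q0 by (simp add: det_stretch unit_ball_vol_pos flip: d_def)
qed

theorem corollary1p3:
  shows "\<not> locally_optimal_covering E8 \<and>
    (\<forall>Q :: real^8^8. associated_form Q E8 \<longrightarrow>
       \<not> (\<exists>U. pqf_neighborhood U Q \<and> (\<forall>Q'\<in>U. covering_density Q \<le> covering_density Q')))"
proof -
  have "\<not> (\<forall>Q'\<in>U. covering_density Q \<le> covering_density Q')"
    if Q: "associated_form Q E8" and U: "pqf_neighborhood U Q" for Q :: "real^8^8" and U
  proof -
    obtain A where A: "is_basis_matrix A E8" "Q = transpose A ** A"
      using Q unfolding associated_form_def by blast
    then have inv: "invertible A" by (simp add: is_basis_matrix_def)
    obtain r where r: "r > 0" "\<And>t x. 0 < t \<Longrightarrow> t < r \<Longrightarrow> covered t x"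
      using stretched_E8_covering by blast
    obtain e where e: "e > 0" "\<And>t. 0 \<le> t \<Longrightarrow> t < e \<Longrightarrow> stretch A t 1 \<in> U"
      using stretch_in_neighborhood[of U A 1] U inv A(2) by blast
    define t where "t = min (1/10) (min r e / 2)"
    have t: "0 < t" "t \<le> 1/10" "t < r" "t < e" using r(1) e(1) by (auto simp: t_def)
    have "covering_density (stretch A t 1) < covering_density Q"
      unfolding A(2) by (rule covering_density_stretch_less[OF A(1) t(1,2) r(2)[OF t(1,3)]])
    moreover have "stretch A t 1 \<in> U" using e(2) t by simp
    ultimately show ?thesis by force
  qed
  then show ?thesis unfolding locally_optimal_covering_def by blast
qed

end
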